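(* Let $\mathbb{P}^e$ be an extended multi-adjoint logic program (EMALP) on an extended multi-adjoint lattice with carrier $L$, and let $\mathbb{P}^{\tilde e}$ be the corresponding constraint-free EMALP of $\mathbb{P}^e$. If $M^{\tilde e}\colon\Pi_{\mathbb{P}^e}\cup\{p_\bot\}\to L$ is a stable model of $\mathbb{P}^{\tilde e}$, then $M^{\tilde e}(p_\bot)=\bot$.
   Context: Adjoint pair: given a partially ordered set $(P,\leq)$, a pair $(\&,\leftarrow)$ of binary operations on $P$ is an adjoint pair if $\&$ is order-preserving in both arguments; $\leftarrow$ is order-preserving in its first argument (the consequent) and order-reversing in its second argument (the antecedent), i.e. $z\leftarrow y$ is increasing in $z$ and decreasing in $y$; and $x\leq (z\leftarrow y)$ iff $(x\& y)\leq z$ for all $x,y,z\in P$. Multi-adjoint lattice: a tuple $(L,\preceq,\leftarrow_1,\&_1,\dots,\leftarrow_r,\&_r)$ where $(L,\preceq)$ is a bounded lattice with bottom $\bot$ and top $\top$, each $(\&_i,\leftarrow_i)$ is an adjoint pair in $(L,\preceq)$, and $\top\&_i\vartheta=\vartheta\&_i\top=\vartheta$ for all $\vartheta\in L$ and all $i$. Extended aggregator: a mapping $@^e\colon L^n\to L$ on a complete lattice $(L,\preceq)$ which is order-preserving in its first $m$ arguments and order-reversing in its last $n-m$ arguments; one writes $@^e[x_1,\dots,x_m;x_{m+1},\dots,x_n]$. An extended multi-adjoint lattice is a multi-adjoint lattice, with $(L,\preceq)$ complete, enriched with a finite family of extended aggregators $@^e_1,\dots,@^e_k$ (arities $n$ and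 numbers $m$ may depend on the aggregator). EMALP: an extended multi-adjoint logic program $\mathbb{P}^e$ on such a lattice is a finite set of weighted rules $\langle p\leftarrow_i @^e[p_1,\dots,p_m;p_{m+1},\dots,p_n];\vartheta\rangle$ and of constraints $\langle c\leftarrow_i @^e[p_1,\dots,p_m;p_{m+1},\dots,p_n];\top\rangle$, where $i\in\{1,\dots,r\}$, $@^e$ is one of the extended aggregators of the lattice, $\vartheta,c\in L$, and $p,p_1,\dots,p_n$ are propositional symbols with $p_1,\dots,p_n$ pairwise distinct. $\Pi_{\mathbb{P}^e}$ denotes the set of propositional symbols appearing in $\mathbb{P}^e$. It is constraint-free if it contains no constraints. Semantics: an interpretation is a mapping $I$ from the set of propositional symbols of the program to $L$, extended by $I(x)=x$ for $x\in L$. Interpretations are ordered pointwise: $I_1\sqsubseteq I_2$ iff $I_1(p)\preceq I_2(p)$ for all $p$. A rule or constraint $\langle l\leftarrow_i @^e[p_1,\dots,p_m;p_{m+1},\dots,p_n];\vartheta\rangle$ ($l$ a propositional symbol or an element of $L$) is satisfied by $I$ iff $\vartheta\preceq I(l)\leftarrow_i @^e[I(p_1),\dots,I(p_m);I(p_{m+1}),\dots,I(p_n)]$. A model is an interpretation satisfying all rules and constraints. The least model is a model $I$ with $I\sqsubseteq J$ for every model $J$. Reduct and stable models: given an interpretation $M$, the reduct of the program with respect to $M$ is obtained by replacing every rule or constraint $\langle l\leftarrow_i @^e[p_1,\dots,p_m;p_{m+1},\dots,p_n];\vartheta\rangle$ by $\langle l\leftarrow_i @^e_M[p_1,\dots,p_m];\vartheta\rangle$,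 where $@^e_M[\vartheta_1,\dots,\vartheta_m]=@^e[\vartheta_1,\dots,\vartheta_m;M(p_{m+1}),\dots,M(p_n)]$; satisfaction and (least) models of the reduct are defined in the same way, over interpretations with the same domain as $M$. $M$ is a stable model of the program if $M$ is the least model of its reduct with respect to $M$. Corresponding constraint-free EMALP: for $c\in L$ let $f_c\colon L\to L$ be given by $f_c(x)=\bot$ if $x\preceq c$ and $f_c(x)=\top$ otherwise. Let $\mathcal{C}_{\mathbb{P}^e}$ be the set of constraints of $\mathbb{P}^e$, $p_\bot\notin\Pi_{\mathbb{P}^e}$ a new propositional symbol, $\&$ any of the conjunctors $\&_1,\dots,\&_r$ of the lattice, and $\neg\colon L\to L$ any negation operator (an order-reversing mapping with $\neg\bot=\top$ and $\neg\top=\bot$). The corresponding constraint-free EMALP is $$\mathbb{P}^{\tilde e}=(\mathbb{P}^e\setminus\mathcal{C}_{\mathbb{P}^e})\cup\{\langle p_\bot\leftarrow_i f_\bot(\neg p_\bot)\,\&\,f_c(\mathcal{B});\top\rangle\mid\langle c\leftarrow_i\mathcal{B};\top\rangle\in\mathcal{C}_{\mathbb{P}^e}\}.$$ For $\mathcal{B}=@^e[p_1,\dots,p_m;p_{m+1},\dots,p_n]$, the body of the new rule is given by the extended aggregator $@^{\tilde e}[p_1,\dots,p_m;p_{m+1},\dots,p_n,p_\bot]=f_\bot(\neg p_\bot)\,\&\,f_c(@^e[p_1,\dots,p_m;p_{m+1},\dots,p_n])$, order-preserving in the first $m$ arguments and order-reversing in the last $n-m+1$; the lattice is enriched with these aggregators.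 Interpretations of $\mathbb{P}^{\tilde e}$ are mappings $\Pi_{\mathbb{P}^e}\cup\{p_\bot\}\to L$. *)

theory Defs
  imports Main "HOL-Library.FuncSet"
begin

section \<open>Extended multi-adjoint lattices\<close>

definition adjoint_pair :: "('a::order \<Rightarrow> 'a \<Rightarrow> 'a) \<Rightarrow> ('a \<Rightarrow> 'a \<Rightarrow> 'a) \<Rightarrow> bool" where
  "adjoint_pair cnj imp \<longleftrightarrow>
     (\<forall>y. mono (\<lambda>x. cnj x y)) \<and> (\<forall>x. mono (\<lambda>y. cnj x y)) \<and>
     (\<forall>y. mono (\<lambda>z. imp z y)) \<and> (\<forall>z. antimono (\<lambda>y. imp z y)) \<and>
     (\<forall>x y z. x \<le> imp z y \<longleftrightarrow> cnj x y \<le> z)"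

text \<open>
  An aggregator \<open>@[x\<^sub>1,\<dots>,x\<^sub>m; x\<^sub>m\<^sub>+\<^sub>1,\<dots>,x\<^sub>n]\<close> takes its first \<open>m\<close> and its last
  \<open>n - m\<close> arguments as two separate lists; only its values on lists of lengths
  \<open>pos_arity\<close> \<open>= m\<close> and \<open>neg_arity\<close> \<open>= n - m\<close> are meaningful.
\<close>

datatype 'l aggregator =
  Aggregator (pos_arity: nat) (neg_arity: nat) (agg_fun: "'l list \<Rightarrow> 'l list \<Rightarrow> 'l")

definition extended_aggregator :: "'l::complete_lattice aggregator \<Rightarrow> bool" where
  "extended_aggregator a \<longleftrightarrow>
     (\<forall>xs xs' ys. length xs = pos_arity a \<and> length ys = neg_arity a \<and> list_all2 (\<le>) xs xs'
        \<longrightarrow> agg_fun a xs ys \<le> agg_fun a xs' ys) \<and>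
     (\<forall>xs ys ys'. length xs = pos_arity a \<and> length ys = neg_arity a \<and> list_all2 (\<le>) ys ys'
        \<longrightarrow> agg_fun a xs ys' \<le> agg_fun a xs ys)"

text \<open>
  The order is that of the type \<open>'l\<close>.  The operators are indexed by \<open>1,\<dots>,num_pairs\<close>;
  \<open>impl L i z y\<close> stands for \<open>z \<leftarrow>\<^sub>i y\<close> (consequent first).
\<close>

record 'l lattice_ops =
  num_pairs :: nat
  conjunctor :: "nat \<Rightarrow> 'l \<Rightarrow> 'l \<Rightarrow> 'l"
  impl :: "nat \<Rightarrow> 'l \<Rightarrow> 'l \<Rightarrow> 'l"
  aggregators :: "'l aggregator set"

definition multi_adjoint_lattice :: "'l::bounded_lattice lattice_ops \<Rightarrow> bool" where
  "multi_adjoint_lattice L \<longleftrightarrow>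
     (\<forall>i\<in>{1..num_pairs L}.
        adjoint_pair (conjunctor L i) (impl L i) \<and>
        (\<forall>x. conjunctor L i top x = x \<and> conjunctor L i x top = x))"

definition extended_multi_adjoint_lattice :: "'l::complete_lattice lattice_ops \<Rightarrow> bool" where
  "extended_multi_adjoint_lattice L \<longleftrightarrow>
     multi_adjoint_lattice L \<and> finite (aggregators L) \<and>
     (\<forall>a\<in>aggregators L. extended_aggregator a)"

definition negation_operator :: "('l::bounded_lattice \<Rightarrow> 'l) \<Rightarrow> bool" where
  "negation_operator ng \<longleftrightarrow> antimono ng \<and> ng bot = top \<and> ng top = bot"


section \<open>Extended multi-adjoint logic programs\<close>

datatype ('p, 'l) head = Sym 'p | Val 'l

text \<open>
  \<open>Clause h i a ps ns w\<close> is \<open>\<langle>h \<leftarrow>\<^sub>i a[ps; ns]; w\<rangle>\<close>: a weighted rule if \<open>h\<close> is a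
  propositional symbol, a constraint if \<open>h\<close> is an element of the lattice.
\<close>

datatype ('p, 'l) clause =
  Clause (head: "('p, 'l) head") (impl_index: nat) (agg: "'l aggregator")
         (pos: "'p list") (neg: "'p list") (weight: 'l)

fun is_constraint :: "('p, 'l) clause \<Rightarrow> bool" where
  "is_constraint (Clause (Sym p) i a ps ns w) = False"
| "is_constraint (Clause (Val c) i a ps ns w) = True"

definition constraints :: "('p, 'l) clause set \<Rightarrow> ('p, 'l) clause set" where
  "constraints P = {r \<in> P. is_constraint r}"

definition constraint_free :: "('p, 'l) clause set \<Rightarrow> bool" where
  "constraint_free P \<longleftrightarrow> constraints P = {}"

definition wf_clause :: "'l::complete_lattice lattice_ops \<Rightarrow> ('p, 'l) clause \<Rightarrow> bool" where
  "wf_clause L r \<longleftrightarrow>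
     impl_index r \<in> {1..num_pairs L} \<and> agg r \<in> aggregators L \<and>
     length (pos r) = pos_arity (agg r) \<and> length (neg r) = neg_arity (agg r) \<and>
     distinct (pos r @ neg r) \<and> (is_constraint r \<longrightarrow> weight r = top)"

definition emalp :: "'l::complete_lattice lattice_ops \<Rightarrow> ('p, 'l) clause set \<Rightarrow> bool" where
  "emalp L P \<longleftrightarrow> finite P \<and> (\<forall>r\<in>P. wf_clause L r)"

fun head_symbols :: "('p, 'l) head \<Rightarrow> 'p set" where
  "head_symbols (Sym p) = {p}"
| "head_symbols (Val c) = {}"

definition symbols :: "('p, 'l) clause set \<Rightarrow> 'p set" where
  "symbols P = (\<Union>r\<in>P. head_symbols (head r) \<union> set (pos r) \<union> set (neg r))"


section \<open>Semantics\<close>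

text \<open>
  An interpretation with domain \<open>D\<close> is an element of \<open>D \<rightarrow>\<^sub>E UNIV\<close>.
\<close>

definition interp_le :: "'p set \<Rightarrow> ('p \<Rightarrow> 'l::order) \<Rightarrow> ('p \<Rightarrow> 'l) \<Rightarrow> bool" where
  "interp_le D I J \<longleftrightarrow> (\<forall>p\<in>D. I p \<le> J p)"

fun head_value :: "('p \<Rightarrow> 'l) \<Rightarrow> ('p, 'l) head \<Rightarrow> 'l" where
  "head_value I (Sym p) = I p"
| "head_value I (Val c) = c"

definition body_value :: "('p \<Rightarrow> 'l) \<Rightarrow> ('p, 'l) clause \<Rightarrow> 'l" where
  "body_value I r = agg_fun (agg r) (map I (pos r)) (map I (neg r))"

definition satisfies ::
  "'l::complete_lattice lattice_ops \<Rightarrow> ('p \<Rightarrow> 'l) \<Rightarrow> ('p, 'l) clause \<Rightarrow> bool" where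
  "satisfies L I r \<longleftrightarrow> weight r \<le> impl L (impl_index r) (head_value I (head r)) (body_value I r)"

definition is_model ::
  "'l::complete_lattice lattice_ops \<Rightarrow> 'p set \<Rightarrow> ('p, 'l) clause set \<Rightarrow> ('p \<Rightarrow> 'l) \<Rightarrow> bool" where
  "is_model L D P I \<longleftrightarrow> I \<in> D \<rightarrow>\<^sub>E UNIV \<and> (\<forall>r\<in>P. satisfies L I r)"

definition is_least_model ::
  "'l::complete_lattice lattice_ops \<Rightarrow> 'p set \<Rightarrow> ('p, 'l) clause set \<Rightarrow> ('p \<Rightarrow> 'l) \<Rightarrow> bool" where
  "is_least_model L D P I \<longleftrightarrow>
     is_model L D P I \<and> (\<forall>J. is_model L D P J \<longrightarrow> interp_le D I J)"

definition reduct_clause :: "('p \<Rightarrow> 'l) \<Rightarrow> ('p, 'l) clause \<Rightarrow> ('p, 'l) clause" where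
  "reduct_clause M r =
     Clause (head r) (impl_index r)
       (Aggregator (pos_arity (agg r)) 0 (\<lambda>xs ys. agg_fun (agg r) xs (map M (neg r))))
       (pos r) [] (weight r)"

definition reduct :: "('p \<Rightarrow> 'l) \<Rightarrow> ('p, 'l) clause set \<Rightarrow> ('p, 'l) clause set" where
  "reduct M P = reduct_clause M ` P"

definition stable_model ::
  "'l::complete_lattice lattice_ops \<Rightarrow> 'p set \<Rightarrow> ('p, 'l) clause set \<Rightarrow> ('p \<Rightarrow> 'l) \<Rightarrow> bool" where
  "stable_model L D P M \<longleftrightarrow> is_least_model L D (reduct M P) M"


section \<open>The corresponding constraint-free program\<close>

text \<open>The map \<open>f\<^sub>c\<close>.\<close>

definition threshold :: "'l::bounded_lattice \<Rightarrow> 'l \<Rightarrow> 'l" where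
  "threshold c x = (if x \<le> c then bot else top)"

text \<open>
  The aggregator \<open>f\<^sub>\<bottom>(\<not> z) & f\<^sub>c(a[xs; ys])\<close>, where \<open>z\<close> is the last antitone argument
  and \<open>&\<close> is the \<open>j\<close>-th conjunctor of \<open>L\<close>.
\<close>

definition cf_aggregator ::
  "'l::complete_lattice lattice_ops \<Rightarrow> nat \<Rightarrow> ('l \<Rightarrow> 'l) \<Rightarrow> 'l \<Rightarrow> 'l aggregator \<Rightarrow> 'l aggregator"
where
  "cf_aggregator L j ng c a =
     Aggregator (pos_arity a) (Suc (neg_arity a))
       (\<lambda>xs ys. conjunctor L j (threshold bot (ng (last ys)))
                               (threshold c (agg_fun a xs (butlast ys))))"

definition cf_lattice ::
  "'l::complete_lattice lattice_ops \<Rightarrow> nat \<Rightarrow> ('l \<Rightarrow> 'l) \<Rightarrow> ('p, 'l) clause set \<Rightarrow> 'l lattice_ops"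
where
  "cf_lattice L j ng P =
     L\<lparr>aggregators := aggregators L \<union>
         {cf_aggregator L j ng c a | c i a ps ns. Clause (Val c) i a ps ns top \<in> constraints P}\<rparr>"

definition cf_program ::
  "'l::complete_lattice lattice_ops \<Rightarrow> nat \<Rightarrow> ('l \<Rightarrow> 'l) \<Rightarrow> 'p \<Rightarrow> ('p, 'l) clause set
    \<Rightarrow> ('p, 'l) clause set"
where
  "cf_program L j ng pbot P =
     (P - constraints P) \<union>
     {Clause (Sym pbot) i (cf_aggregator L j ng c a) ps (ns @ [pbot]) top | c i a ps ns.
        Clause (Val c) i a ps ns top \<in> constraints P}"

lemma constraint_free_cf_program: "constraint_free (cf_program L j ng pbot P)"
  by (auto simp: constraint_free_def constraints_def cf_program_def)

lemma threshold_mono: "x \<le> y \<Longrightarrow> threshold c x \<le> threshold c y"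
  by (auto simp: threshold_def intro: order_trans)

lemma extended_aggregator_cf_aggregator:
  assumes a: "extended_aggregator a" and L: "multi_adjoint_lattice L"
    and j: "j \<in> {1..num_pairs L}" and ng: "negation_operator ng"
  shows "extended_aggregator (cf_aggregator L j ng c a)"
proof -
  have adj: "adjoint_pair (conjunctor L j) (impl L j)"
    using L j by (auto simp: multi_adjoint_lattice_def)
  have cnj: "conjunctor L j x y \<le> conjunctor L j x' y'" if "x \<le> x'" "y \<le> y'" for x y x' y'
  proof -
    have "conjunctor L j x y \<le> conjunctor L j x' y"
      using adj that(1) unfolding adjoint_pair_def mono_def by blast
    also have "\<dots> \<le> conjunctor L j x' y'"
      using adj that(2) unfolding adjoint_pair_def mono_def by blast
    finally show ?thesis .
  qed
  have last: "last ys \<le> last ys'" and butlast: "list_all2 (\<le>) (butlast ys) (butlast ys')"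
    if "length ys = Suc n" "list_all2 (\<le>) ys ys'" for ys ys' :: "'a list" and n
  proof -
    have len: "length ys' = Suc n"
      using that by (simp add: list_all2_lengthD)
    then have "ys \<noteq> []" "ys' \<noteq> []"
      using that(1) by auto
    then show "last ys \<le> last ys'"
      using that len by (auto simp: last_conv_nth list_all2_conv_all_nth)
    show "list_all2 (\<le>) (butlast ys) (butlast ys')"
      using that len by (auto simp: list_all2_conv_all_nth nth_butlast)
  qed
  show ?thesis
    unfolding extended_aggregator_def cf_aggregator_def aggregator.sel
  proof (intro conjI allI impI; elim conjE)
    fix xs xs' ys :: "'a list"
    assume "length xs = pos_arity a" "length ys = Suc (neg_arity a)" "list_all2 (\<le>) xs xs'"
    then have "agg_fun a xs (butlast ys) \<le> agg_fun a xs' (butlast ys)"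
      using a by (simp add: extended_aggregator_def)
    then show "conjunctor L j (threshold bot (ng (last ys))) (threshold c (agg_fun a xs (butlast ys)))
       \<le> conjunctor L j (threshold bot (ng (last ys))) (threshold c (agg_fun a xs' (butlast ys)))"
      by (intro cnj threshold_mono order_refl)
  next
    fix xs ys ys' :: "'a list"
    assume *: "length xs = pos_arity a" "length ys = Suc (neg_arity a)" "list_all2 (\<le>) ys ys'"
    have "agg_fun a xs (butlast ys') \<le> agg_fun a xs (butlast ys)"
      using a * butlast[OF *(2,3)] by (simp add: extended_aggregator_def)
    moreover have "ng (last ys') \<le> ng (last ys)"
      using ng last[OF *(2,3)] by (auto simp: negation_operator_def antimono_def)
    ultimately show
      "conjunctor L j (threshold bot (ng (last ys'))) (threshold c (agg_fun a xs (butlast ys')))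
       \<le> conjunctor L j (threshold bot (ng (last ys))) (threshold c (agg_fun a xs (butlast ys)))"
      by (intro cnj threshold_mono)
  qed
qed

lemma extended_multi_adjoint_lattice_cf_lattice:
  assumes L: "extended_multi_adjoint_lattice L" and P: "emalp L P"
    and j: "j \<in> {1..num_pairs L}" and ng: "negation_operator ng"
  shows "extended_multi_adjoint_lattice (cf_lattice L j ng P)"
proof -
  let ?A = "{cf_aggregator L j ng c a | c i a ps ns. Clause (Val c) i a ps ns top \<in> constraints P}"
  have ops: "num_pairs (cf_lattice L j ng P) = num_pairs L"
    "conjunctor (cf_lattice L j ng P) = conjunctor L" "impl (cf_lattice L j ng P) = impl L"
    "aggregators (cf_lattice L j ng P) = aggregators L \<union> ?A"
    by (simp_all add: cf_lattice_def)
  have "?A \<subseteq> (\<lambda>r. cf_aggregator L j ng (case head r of Sym _ \<Rightarrow> bot | Val c \<Rightarrow> c) (agg r)) ` P"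
    by (force simp: constraints_def)
  then have "finite ?A"
    by (rule finite_subset) (use P in \<open>simp add: emalp_def\<close>)
  moreover have "\<forall>b\<in>?A. extended_aggregator b"
  proof
    fix b assume b: "b \<in> ?A"
    obtain c i a ps ns where "b = cf_aggregator L j ng c a" "Clause (Val c) i a ps ns top \<in> P"
      using b by (auto simp: constraints_def)
    moreover from this have "a \<in> aggregators L"
      using P by (fastforce simp: emalp_def wf_clause_def)
    ultimately show "extended_aggregator b"
      using L j ng by (simp add: extended_multi_adjoint_lattice_def extended_aggregator_cf_aggregator)
  qed
  ultimately show ?thesis
    using L
    unfolding extended_multi_adjoint_lattice_def multi_adjoint_lattice_def ops ball_Un finite_Un
    by blast
qed

lemma emalp_cf_program:
  assumes P: "emalp L P" and pbot: "pbot \<notin> symbols P"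
  shows "emalp (cf_lattice L j ng P) (cf_program L j ng pbot P)"
proof -
  let ?R = "{Clause (Sym pbot) i (cf_aggregator L j ng c a) ps (ns @ [pbot]) top | c i a ps ns.
               Clause (Val c) i a ps ns top \<in> constraints P}"
  have "?R \<subseteq> (\<lambda>r. Clause (Sym pbot) (impl_index r)
      (cf_aggregator L j ng (case head r of Sym _ \<Rightarrow> bot | Val c \<Rightarrow> c) (agg r))
      (pos r) (neg r @ [pbot]) top) ` P"
    by (force simp: constraints_def)
  then have "finite ?R"
    by (rule finite_subset) (use P in \<open>simp add: emalp_def\<close>)
  moreover have "wf_clause (cf_lattice L j ng P) r" if r: "r \<in> ?R" for r
  proof -
    obtain c i a ps ns where
      r: "r = Clause (Sym pbot) i (cf_aggregator L j ng c a) ps (ns @ [pbot]) top"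
      and C: "Clause (Val c) i a ps ns top \<in> constraints P"
      using r by auto
    then have "Clause (Val c) i a ps ns top \<in> P"
      by (simp add: constraints_def)
    then have wf: "wf_clause L (Clause (Val c) i a ps ns top)" and fresh: "pbot \<notin> set ps \<union> set ns"
      using P pbot by (fastforce simp: emalp_def symbols_def)+
    have "cf_aggregator L j ng c a \<in> aggregators (cf_lattice L j ng P)"
      using C by (auto simp: cf_lattice_def)
    then show ?thesis
      using wf fresh by (auto simp: r wf_clause_def cf_lattice_def cf_aggregator_def)
  qed
  moreover have "wf_clause (cf_lattice L j ng P) r" if "r \<in> P - constraints P" for r
    using P that by (auto simp: emalp_def wf_clause_def cf_lattice_def)
  ultimately show ?thesis
    using P unfolding emalp_def cf_program_def ball_Un by blast
qed

end

theory Submission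
  imports Defs
begin

text \<open>
  A clause with head \<open>p\<^sub>\<bottom>\<close> has body value \<open>\<bottom>\<close> or \<open>\<top>\<close>; the value \<open>\<top>\<close> would force
  \<open>M(p\<^sub>\<bottom>) = \<top>\<close>, hence \<open>f\<^sub>\<bottom>(\<not> M(p\<^sub>\<bottom>)) = \<bottom>\<close>, a contradiction.  So under \<open>M\<close> all
  these bodies are \<open>\<bottom>\<close>, and since \<open>p\<^sub>\<bottom>\<close> never occurs positively, resetting
  it to \<open>\<bottom>\<close> yields another model of the reduct, to be compared with the least one \<open>M\<close>.
\<close>

text \<open>Adjointness, with \<open>top\<close> as left unit; it turns clauses of weight
  \<open>top\<close> into plain inequalities.\<close>

lemma top_le_impl_iff:
  fixes L :: "'l::bounded_lattice lattice_ops"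
  assumes "multi_adjoint_lattice L" and "i \<in> {1..num_pairs L}"
  shows "top \<le> impl L i z y \<longleftrightarrow> y \<le> z"
  using assms by (auto simp: multi_adjoint_lattice_def adjoint_pair_def)

text \<open>Adjoint form of the trivial bound \<open>bot \<le> impl L i bot y\<close>.\<close>

lemma conjunctor_bot_left:
  fixes L :: "'l::bounded_lattice lattice_ops"
  assumes "multi_adjoint_lattice L" and "i \<in> {1..num_pairs L}"
  shows "conjunctor L i bot y = bot"
proof -
  have "bot \<le> impl L i bot y \<longleftrightarrow> conjunctor L i bot y \<le> bot"
    using assms unfolding multi_adjoint_lattice_def adjoint_pair_def by blast
  then show ?thesis
    by (simp add: bot_unique)
qed

text \<open>Both factors are \<open>bot\<close> or \<open>top\<close>, hence so is the conjunction,
  as \<open>bot\<close> absorbs on the left and \<open>top\<close> is a left unit.\<close>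

lemma cf_body_eq_bot:
  fixes L :: "'l::bounded_lattice lattice_ops"
  assumes L: "multi_adjoint_lattice L" and j: "j \<in> {1..num_pairs L}"
    and ng: "negation_operator ng"
    and le: "conjunctor L j (threshold bot (ng x)) (threshold c y) \<le> x"
  shows "conjunctor L j (threshold bot (ng x)) (threshold c y) = bot"
proof (cases "x = top")
  case True
  then show ?thesis
    using ng conjunctor_bot_left[OF L j] by (simp add: negation_operator_def threshold_def)
next
  case False
  have "conjunctor L j top u = u" for u
    using L j by (simp add: multi_adjoint_lattice_def)
  then show ?thesis
    using False le conjunctor_bot_left[OF L j]
    by (auto simp: threshold_def top_unique split: if_splits)
qed

lemma satisfies_reduct_clause_iff:
  "satisfies L I (reduct_clause M r) \<longleftrightarrow>
     weight r \<le> impl L (impl_index r) (head_value I (head r))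
       (agg_fun (agg r) (map I (pos r)) (map M (neg r)))"
  by (simp add: satisfies_def reduct_clause_def body_value_def)

text \<open>Only the set \<open>aggregators\<close> differs, and satisfaction never consults
  it.\<close>

lemma satisfies_cf_lattice [simp]: "satisfies (cf_lattice L j ng P) = satisfies L"
  by (simp add: fun_eq_iff satisfies_def cf_lattice_def)

theorem theorem19:
  fixes L :: "'l::complete_lattice lattice_ops"
    and P :: "('p, 'l) clause set"
    and M :: "'p \<Rightarrow> 'l"
    and ng :: "'l \<Rightarrow> 'l"
    and pbot :: 'p
    and j :: nat
  assumes "extended_multi_adjoint_lattice L"
    and "emalp L P"
    and "pbot \<notin> symbols P"
    and "j \<in> {1..num_pairs L}"
    and "negation_operator ng"
    and "stable_model (cf_lattice L j ng P) (insert pbot (symbols P)) (cf_program L j ng pbot P) M"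
  shows "M pbot = bot"
proof -
  note L = assms(1)[unfolded extended_multi_adjoint_lattice_def, THEN conjunct1]
  note P = assms(2) and fresh = assms(3)
  let ?D = "insert pbot (symbols P)" and ?Q = "cf_program L j ng pbot P"
  let ?J = "M(pbot := bot)"
  have dom: "M \<in> ?D \<rightarrow>\<^sub>E UNIV"
    and sat: "\<And>r. r \<in> ?Q \<Longrightarrow> satisfies L M (reduct_clause M r)"
    and least: "\<And>I. is_model (cf_lattice L j ng P) ?D (reduct M ?Q) I \<Longrightarrow> interp_le ?D M I"
    using assms(6) by (auto simp: stable_model_def is_least_model_def is_model_def reduct_def)
  have "satisfies L ?J (reduct_clause M r)" if r: "r \<in> ?Q" for r
  proof -
    consider "r \<in> P - constraints P"
      | c i a ps ns where "r = Clause (Sym pbot) i (cf_aggregator L j ng c a) ps (ns @ [pbot]) top"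
          "Clause (Val c) i a ps ns top \<in> P"
      using r by (auto simp: cf_program_def constraints_def)
    then show ?thesis
    proof cases
      case 1
      then have "pbot \<notin> head_symbols (head r) \<union> set (pos r)"
        using fresh by (auto simp: symbols_def)
      \<comment> \<open>Negative symbols are frozen at \<open>M\<close> in the reduct, so only these
        two parts could change.\<close>
      then have "head_value ?J (head r) = head_value M (head r)"
        and "map ?J (pos r) = map M (pos r)"
        by (cases "head r"; auto)+
      then show ?thesis
        using sat[OF r] by (simp only: satisfies_reduct_clause_iff)
    next
      case (2 c i a ps ns)
      have i: "i \<in> {1..num_pairs L}"
        using P 2(2) by (fastforce simp: emalp_def wf_clause_def)
      have "pbot \<notin> set ps"
        using fresh 2(2) by (force simp: symbols_def)
      then have J: "map ?J ps = map M ps"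
        by auto
      \<comment> \<open>The appended negative \<open>pbot\<close> is read at \<open>M pbot\<close>,
        which is also the head value bounding this body.\<close>
      have "conjunctor L j (threshold bot (ng (M pbot)))
          (threshold c (agg_fun a (map M ps) (map M ns))) = bot"
        using sat[OF r] 2(1) by (intro cf_body_eq_bot[OF L assms(4,5)])
          (simp add: satisfies_reduct_clause_iff cf_aggregator_def top_le_impl_iff[OF L i])
      then show ?thesis
        by (simp add: 2(1) J satisfies_reduct_clause_iff cf_aggregator_def top_le_impl_iff[OF L i]
            del: map_fun_upd)
    qed
  qed
  \<comment> \<open>The update is at a point of \<open>?D\<close>, so extensionality
    survives.\<close>
  moreover have "?J \<in> ?D \<rightarrow>\<^sub>E UNIV"
    using dom by (auto simp: PiE_def extensional_def)
  ultimately have "interp_le ?D M ?J"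
    by (intro least) (auto simp: is_model_def reduct_def)
  then show ?thesis
    by (simp add: interp_le_def bot_unique)
qed

end
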